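(* Let $A\in\mathbb{R}^{m\times n}$ have no zero columns, let $0<\omega<2$, and let $\ell\ge 1$ be an integer. Let $M$ and $H$ be the NR-SSOR splitting matrix and iteration matrix of $A$ with relaxation parameter $\omega$ (as defined in the context). Then $$C^{(\ell)}=\sum_{i=0}^{\ell-1}H^{i}M^{-1}$$ is positive definite.
   Context: For $A\in\mathbb{R}^{m\times n}$ write $A^{\mathrm T}A=L+D+L^{\mathrm T}$, with $L$ strictly lower triangular and $D$ diagonal. For a relaxation parameter $\omega$ (with $0<\omega<2$), NR-SSOR is the SSOR method applied to the normal equations $A^{\mathrm T}A x=A^{\mathrm T}b$; its splitting matrix and iteration matrix are $$M=\omega^{-1}(2-\omega)^{-1}(D+\omega L)D^{-1}(D+\omega L^{\mathrm T}),\qquad H=I-M^{-1}A^{\mathrm T}A .$$ When $A$ has no zero columns and $0<\omega<2$, $M$ is symmetric positive definite (in particular nonsingular). The matrix $C^{(\ell)}$ is symmetric; positive definite means $y^{\mathrm T}C^{(\ell)}y>0$ for all nonzero $y\in\mathbb{R}^n$. *)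

theory Defs
  imports "HOL-Analysis.Analysis"
begin

text \<open>
  The column index type carries a linear order, which gives meaning to
  ``strictly lower triangular'' (row index greater than column index).
\<close>

definition strict_lower_part ::
    "real^('n::{finite,linorder})^('n::{finite,linorder}) \<Rightarrow>
      real^('n::{finite,linorder})^('n::{finite,linorder})" where
  "strict_lower_part G = (\<chi> i j. if j < i then G $ i $ j else 0)"

definition diagonal_part :: "real^'n^'n \<Rightarrow> real^'n^'n" where
  "diagonal_part G = (\<chi> i j. if i = j then G $ i $ j else 0)"

lemma gram_splitting:
  fixes A :: "real^('n::{finite,linorder})^'m"
  defines "G \<equiv> transpose A ** A"
  shows "G = strict_lower_part G + diagonal_part G + transpose (strict_lower_part G)"
proof -
  have "G $ i $ j = G $ j $ i" for i j
    by (simp add: G_def matrix_matrix_mult_def transpose_def mult.commute)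
  then show ?thesis
    by (auto simp: vec_eq_iff strict_lower_part_def diagonal_part_def transpose_def)
qed

definition ssor_splitting_matrix ::
    "real \<Rightarrow> real^('n::{finite,linorder})^('n::{finite,linorder}) \<Rightarrow>
      real^('n::{finite,linorder})^('n::{finite,linorder})" where
  "ssor_splitting_matrix \<omega> G =
     (let L = strict_lower_part G; D = diagonal_part G in
      (inverse \<omega> * inverse (2 - \<omega>)) *\<^sub>R
        ((D + \<omega> *\<^sub>R L) ** matrix_inv D ** (D + \<omega> *\<^sub>R transpose L)))"

definition nr_ssor_M ::
    "real \<Rightarrow> real^('n::{finite,linorder})^'m \<Rightarrow>
      real^('n::{finite,linorder})^('n::{finite,linorder})" where
  "nr_ssor_M \<omega> A = ssor_splitting_matrix \<omega> (transpose A ** A)"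

definition nr_ssor_H ::
    "real \<Rightarrow> real^('n::{finite,linorder})^'m \<Rightarrow>
      real^('n::{finite,linorder})^('n::{finite,linorder})" where
  "nr_ssor_H \<omega> A = mat 1 - matrix_inv (nr_ssor_M \<omega> A) ** (transpose A ** A)"

text \<open>
  The library's power operation on \<^typ>\<open>real^'n^'n\<close> is entrywise, hence a
  separate power with respect to the matrix product.
\<close>

primrec matrix_pow :: "real^'n^'n \<Rightarrow> nat \<Rightarrow> real^'n^'n" where
  "matrix_pow H 0 = mat 1"
| "matrix_pow H (Suc i) = H ** matrix_pow H i"

definition nr_ssor_C ::
    "real \<Rightarrow> real^('n::{finite,linorder})^'m \<Rightarrow> nat \<Rightarrow>
      real^('n::{finite,linorder})^('n::{finite,linorder})" where
  "nr_ssor_C \<omega> A l =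
     (\<Sum>i<l. matrix_pow (nr_ssor_H \<omega> A) i ** matrix_inv (nr_ssor_M \<omega> A))"

text \<open>Symmetry is not part of this notion.\<close>

definition positive_definite :: "real^'n^'n \<Rightarrow> bool" where
  "positive_definite C \<longleftrightarrow> (\<forall>y. y \<noteq> 0 \<longrightarrow> y \<bullet> (C *v y) > 0)"

end

theory Submission
  imports Defs
begin

text \<open>
  Put \<open>G = A\<^sup>T A\<close>, \<open>P = M\<^sup>-\<^sup>1\<close> and \<open>N = M - G\<close>, so that \<open>H = P N\<close>. Expanding both products gives
  \<open>\<omega> (2 - \<omega>) N = ((1 - \<omega>) D - \<omega> L) D\<^sup>-\<^sup>1 ((1 - \<omega>) D - \<omega> L)\<^sup>T\<close>, hence \<open>N\<close> is positive semidefinite.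
  Since \<open>H P = P H\<^sup>T\<close>, the terms satisfy \<open>H\<^bsup>i+2\<^esup> P = H (H\<^sup>i P) H\<^sup>T\<close>; starting from \<open>P\<close> and
  \<open>P N P\<close> they are all positive semidefinite, and the first one, \<open>P\<close>, is positive definite.
\<close>

section \<open>Quadratic forms: sums, congruences and inverses\<close>

definition positive_semidefinite :: "real^'n^'n \<Rightarrow> bool" where
  "positive_semidefinite C \<longleftrightarrow> (\<forall>y. 0 \<le> y \<bullet> (C *v y))"

lemma positive_definite_imp_positive_semidefinite:
  "positive_definite C \<Longrightarrow> positive_semidefinite C"
  unfolding positive_definite_def positive_semidefinite_def
  by (metis inner_zero_left order.strict_implies_order order_refl)

lemma positive_definite_add_semidefinite:
  assumes "positive_definite B" "positive_semidefinite C"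
  shows "positive_definite (B + C)"
  using assms unfolding positive_definite_def positive_semidefinite_def
  by (simp add: matrix_vector_mult_add_rdistrib inner_add_right add_pos_nonneg)

lemma positive_semidefinite_sum:
  assumes "\<And>i. i \<in> I \<Longrightarrow> positive_semidefinite (f i)"
  shows "positive_semidefinite (\<Sum>i\<in>I. f i)"
  using assms
proof (induction I rule: infinite_finite_induct)
  case (insert i I)
  then show ?case
    by (simp add: positive_semidefinite_def matrix_vector_mult_add_rdistrib inner_add_right)
qed (auto simp: positive_semidefinite_def)

lemma inner_matrix_vector_mult:
  fixes A :: "real^'n^'m"
  shows "x \<bullet> (A *v y) = (transpose A *v x) \<bullet> y"
  by (simp add: dot_lmul_matrix)

lemma inner_congruence:
  fixes B :: "real^'n^'m" and C :: "real^'n^'n"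
  shows "y \<bullet> ((B ** C ** transpose B) *v y) = (transpose B *v y) \<bullet> (C *v (transpose B *v y))"
  by (simp add: inner_matrix_vector_mult flip: matrix_vector_mul_assoc)

lemma positive_semidefinite_congruence:
  fixes B :: "real^'n^'m"
  assumes "positive_semidefinite C"
  shows "positive_semidefinite (B ** C ** transpose B)"
  using assms unfolding positive_semidefinite_def inner_congruence by blast

text \<open>The kernel condition keeps \<open>transpose B *v y\<close> nonzero, so strict positivity
  of \<open>C\<close> carries over.\<close>

lemma positive_definite_congruence:
  fixes B :: "real^'n^'m"
  assumes "positive_definite C" and "\<And>y. transpose B *v y = 0 \<Longrightarrow> y = 0"
  shows "positive_definite (B ** C ** transpose B)"
  using assms unfolding positive_definite_def inner_congruence by blast

lemma positive_semidefinite_scaleR: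
  "positive_semidefinite C \<Longrightarrow> 0 \<le> c \<Longrightarrow> positive_semidefinite (c *\<^sub>R C)"
  by (simp add: positive_semidefinite_def flip: scaleR_matrix_vector_assoc)

lemma positive_definite_scaleR:
  "positive_definite C \<Longrightarrow> 0 < c \<Longrightarrow> positive_definite (c *\<^sub>R C)"
  by (simp add: positive_definite_def flip: scaleR_matrix_vector_assoc)

lemma invertible_matrix_inv:
  fixes B :: "'a::field^'n^'n"
  assumes "invertible B"
  shows "B ** matrix_inv B = mat 1" "matrix_inv B ** B = mat 1"
  using someI_ex[OF assms[unfolded invertible_def]] unfolding matrix_inv_def by blast+

lemma positive_definite_invertible:
  assumes "positive_definite B"
  shows "invertible B"
proof -
  have "inj ((*v) B)"
  proof (rule injI)
    fix x y assume "B *v x = B *v y"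
    then have "B *v (x - y) = 0"
      by (simp add: matrix_vector_mult_diff_distrib)
    then show "x = y"
      using assms unfolding positive_definite_def
      by (metis inner_zero_right less_irrefl right_minus_eq)
  qed
  then show ?thesis
    by (simp add: invertible_left_inverse matrix_left_invertible_injective)
qed

text \<open>Transposing \<open>B ** matrix_inv B = mat 1\<close> gives a left inverse of
  \<open>B\<close>, which must agree with its right inverse.\<close>

lemma transpose_matrix_inv:
  fixes B :: "'a::field^'n^'n"
  assumes "invertible B" "transpose B = B"
  shows "transpose (matrix_inv B) = matrix_inv B"
proof -
  have "transpose (matrix_inv B) ** B = mat 1"
    using arg_cong[OF invertible_matrix_inv(1)[OF assms(1)], of transpose] assms(2)
    by (simp add: matrix_transpose_mul)
  then show ?thesis
    by (metis assms(1) invertible_matrix_inv(1) matrix_mul_assoc matrix_mul_lid matrix_mul_rid)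
qed

text \<open>The inverse is itself a congruence of \<open>B\<close>: it equals
  \<open>matrix_inv B ** B ** transpose (matrix_inv B)\<close>.\<close>

lemma positive_definite_matrix_inv:
  assumes "positive_definite B" "transpose B = B"
  shows "positive_definite (matrix_inv B)"
proof -
  have inv: "invertible B"
    using assms(1) by (rule positive_definite_invertible)
  have sym: "transpose (matrix_inv B) = matrix_inv B"
    using inv assms(2) by (rule transpose_matrix_inv)
  have "y = 0" if "matrix_inv B *v y = 0" for y
    by (metis that inv invertible_matrix_inv(1) matrix_vector_mul_assoc matrix_vector_mul_lid
        matrix_vector_mult_0_right)
  then have "positive_definite (matrix_inv B ** B ** transpose (matrix_inv B))"
    using assms(1) by (intro positive_definite_congruence) (auto simp: sym)
  then show ?thesis
    by (simp add: sym invertible_matrix_inv(2)[OF inv])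
qed

section \<open>Matrix algebra and truncated Neumann sums\<close>

lemma matrix_diff_ldistrib:
  fixes A :: "'a::ring_1^'n^'m" and B C :: "'a^'p^'n"
  shows "A ** (B - C) = A ** B - A ** C"
  by (vector matrix_matrix_mult_def sum_subtractf right_diff_distrib)

lemma matrix_add_rdistrib:
  fixes A B :: "'a::semiring_1^'n^'m" and C :: "'a^'p^'n"
  shows "(A + B) ** C = A ** C + B ** C"
  by (vector matrix_matrix_mult_def sum.distrib distrib_right)

lemma transpose_add: "transpose (A + B) = transpose A + transpose B"
  by (simp add: vec_eq_iff transpose_def)

lemma transpose_diff: "transpose (A - B) = transpose A - transpose B"
  by (simp add: vec_eq_iff transpose_def)

text \<open>For \<open>i = 0\<close> both sides are \<open>P ** N ** P\<close>, and multiplying by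
  \<open>P ** N\<close> on the left preserves the equation. This lets one factor of the power
  reappear transposed on the right, as a congruence requires.\<close>

lemma neumann_term_symmetry:
  fixes P N :: "real^'n^'n"
  assumes "transpose P = P" "transpose N = N"
  shows "matrix_pow (P ** N) (Suc i) ** P = matrix_pow (P ** N) i ** P ** transpose (P ** N)"
proof (induction i)
  case 0
  then show ?case
    by (simp add: assms matrix_transpose_mul matrix_mul_assoc)
next
  case (Suc i)
  have "matrix_pow (P ** N) (Suc (Suc i)) ** P = (P ** N) ** (matrix_pow (P ** N) (Suc i) ** P)"
    by (simp add: matrix_mul_assoc)
  also have "\<dots> = (P ** N) ** (matrix_pow (P ** N) i ** P ** transpose (P ** N))"
    by (simp only: Suc.IH)
  also have "\<dots> = matrix_pow (P ** N) (Suc i) ** P ** transpose (P ** N)"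
    by (simp add: matrix_mul_assoc)
  finally show ?case .
qed

lemma positive_semidefinite_neumann_term:
  fixes P N :: "real^'n^'n"
  assumes "transpose P = P" "transpose N = N" "positive_semidefinite P" "positive_semidefinite N"
  shows "positive_semidefinite (matrix_pow (P ** N) i ** P)"
proof (induction i rule: induct_nat_012)
  case 0
  then show ?case
    using assms(3) by simp
next
  case 1
  then show ?case
    using positive_semidefinite_congruence[OF assms(4), of P] by (simp add: assms(1))
next
  case (ge2 i)
  \<comment> \<open>One factor moves to the right by symmetry; the recursion of
    \<open>matrix_pow\<close> releases another on the left. The index therefore grows by two per
    congruence.\<close>
  have "matrix_pow (P ** N) (Suc (Suc i)) ** P
      = (P ** N) ** (matrix_pow (P ** N) i ** P) ** transpose (P ** N)"
    unfolding neumann_term_symmetry[OF assms(1,2), of "Suc i"] by (simp add: matrix_mul_assoc)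
  then show ?case
    using positive_semidefinite_congruence[OF ge2(1), of "P ** N"] by simp
qed

lemma positive_definite_neumann_sum:
  fixes P N :: "real^'n^'n"
  assumes "transpose P = P" "transpose N = N" "positive_definite P" "positive_semidefinite N"
    and "0 < l"
  shows "positive_definite (\<Sum>i<l. matrix_pow (P ** N) i ** P)"
proof -
  let ?f = "\<lambda>i. matrix_pow (P ** N) i ** P"
  have "positive_semidefinite (\<Sum>i\<in>{0<..<l}. ?f i)"
    using positive_semidefinite_neumann_term[OF assms(1,2)
        positive_definite_imp_positive_semidefinite[OF assms(3)] assms(4)]
    by (rule positive_semidefinite_sum)
  \<comment> \<open>Since \<open>0 < l\<close>, the index 0 occurs; its term is \<open>P\<close>,
    the only source of strict positivity here.\<close>
  moreover have "{..<l} = insert 0 {0<..<l}"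
    using \<open>0 < l\<close> by auto
  ultimately show ?thesis
    using assms(3) by (simp add: positive_definite_add_semidefinite)
qed

section \<open>Products of triangular factors; diagonal and triangular parts\<close>

lemma triangular_product_expansion:
  fixes D X Y Q :: "real^'n^'n"
  assumes "D ** Q = mat 1" "Q ** D = mat 1"
  shows "(a *\<^sub>R D + b *\<^sub>R X) ** Q ** (a *\<^sub>R D + b *\<^sub>R Y)
    = a\<^sup>2 *\<^sub>R D + (a * b) *\<^sub>R (X + Y) + b\<^sup>2 *\<^sub>R (X ** Q ** Y)"
proof -
  \<comment> \<open>The mixed products collapse to \<open>X\<close> and \<open>Y\<close>; simp needs
    help only where \<open>Q ** D\<close> is not bracketed.\<close>
  have "X ** Q ** D = X"
    by (simp add: assms flip: matrix_mul_assoc)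
  then show ?thesis
    using assms
    by (simp add: matrix_add_ldistrib matrix_add_rdistrib matrix_scalar_ac
        algebra_simps power2_eq_square flip: scalar_matrix_assoc)
qed

lemma transpose_diagonal_part [simp]: "transpose (diagonal_part G) = diagonal_part G"
  by (simp add: vec_eq_iff transpose_def diagonal_part_def)

lemma diagonal_part_mult_vec: "(diagonal_part G *v y) $ i = G $ i $ i * y $ i"
  by (simp add: diagonal_part_def matrix_vector_mult_def if_distrib[of "\<lambda>x. x * _"] cong: if_cong)

lemma positive_definite_diagonal_part:
  assumes "\<And>i. 0 < G $ i $ i"
  shows "positive_definite (diagonal_part G)"
  unfolding positive_definite_def
proof (intro allI impI)
  fix y :: "real^'a" assume "y \<noteq> 0"
  then obtain j where "y $ j \<noteq> 0"
    by (auto simp: vec_eq_iff)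
  then have "0 < G $ j $ j * (y $ j)\<^sup>2"
    using assms by simp
  also have "\<dots> \<le> (\<Sum>i\<in>UNIV. G $ i $ i * (y $ i)\<^sup>2)"
    by (rule member_le_sum) (auto simp: assms less_imp_le)
  also have "\<dots> = y \<bullet> (diagonal_part G *v y)"
    by (simp add: inner_vec_def diagonal_part_mult_vec power2_eq_square mult_ac)
  finally show "0 < y \<bullet> (diagonal_part G *v y)" .
qed

text \<open>Back substitution: at the largest index \<open>i\<close> with
  \<open>y $ i \<noteq> 0\<close>, the strictly upper part sees only entries \<open>y $ j\<close>
  with \<open>i < j\<close>, which vanish. Row \<open>i\<close> then reads
  \<open>G $ i $ i * y $ i = 0\<close>.\<close>

lemma upper_triangular_mult_vec_eq_0:
  fixes y :: "real^('n::{finite,linorder})"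
  assumes "\<And>i. G $ i $ i \<noteq> 0"
    and eq: "(diagonal_part G + w *\<^sub>R transpose (strict_lower_part G)) *v y = 0"
  shows "y = 0"
proof (rule ccontr)
  assume "y \<noteq> 0"
  then have ne: "{j. y $ j \<noteq> 0} \<noteq> {}"
    by (auto simp: vec_eq_iff)
  define i where "i = Max {j. y $ j \<noteq> 0}"
  have i: "y $ i \<noteq> 0"
    using Max_in[OF _ ne] by (simp add: i_def)
  have zero: "y $ j = 0" if "i < j" for j
    using Max_ge[of "{j. y $ j \<noteq> 0}" j] that unfolding i_def[symmetric]
    by (meson finite_code leD mem_Collect_eq)
  have "(transpose (strict_lower_part G) *v y) $ i = 0"
    by (auto simp: matrix_vector_mult_def transpose_def strict_lower_part_def zero intro!: sum.neutral)
  moreover have "((diagonal_part G + w *\<^sub>R transpose (strict_lower_part G)) *v y) $ i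
      = G $ i $ i * y $ i + w * (transpose (strict_lower_part G) *v y) $ i"
    by (simp only: matrix_vector_mult_add_rdistrib diagonal_part_mult_vec vector_add_component
        vector_scaleR_component flip: scaleR_matrix_vector_assoc) simp
  ultimately have "G $ i $ i * y $ i = 0"
    using eq by simp
  then show False
    using i assms(1) by simp
qed

section \<open>The normal equations and the NR-SSOR splitting\<close>

lemma gram_diagonal_pos:
  fixes A :: "real^'n^'m"
  assumes "column i A \<noteq> 0"
  shows "0 < (transpose A ** A) $ i $ i"
proof -
  have "(transpose A ** A) $ i $ i = column i A \<bullet> column i A"
    by (simp add: matrix_matrix_mult_def transpose_def column_def inner_vec_def)
  then show ?thesis
    using assms by simp
qed

theorem theorem2:
  fixes A :: "real^('n::{finite,linorder})^'m" and \<omega> :: real and l :: nat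
  assumes "\<forall>j. column j A \<noteq> 0"
    and "0 < \<omega>" and "\<omega> < 2"
    and "l \<ge> 1"
  shows "positive_definite (nr_ssor_C \<omega> A l)"
proof -
  define G where "G = transpose A ** A"
  define D where "D = diagonal_part G"
  define L where "L = strict_lower_part G"
  define Q where "Q = matrix_inv D"
  define M where "M = nr_ssor_M \<omega> A"
  define P where "P = matrix_inv M"
  define c where "c = inverse \<omega> * inverse (2 - \<omega>)"
  have c: "0 < c" "c * (\<omega> * (2 - \<omega>)) = 1"
    using assms(2,3) by (simp_all add: c_def field_simps)
  have G: "G = L + D + transpose L"
    unfolding D_def L_def G_def by (rule gram_splitting)
  have symG: "transpose G = G"
    by (simp add: G_def matrix_transpose_mul)
  have diag: "0 < G $ i $ i" for i
    using assms(1) by (simp add: G_def gram_diagonal_pos)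
  have symD: "transpose D = D"
    by (simp add: D_def)
  have pdD: "positive_definite D"
    unfolding D_def by (rule positive_definite_diagonal_part) (rule diag)
  have invD: "invertible D"
    using pdD by (rule positive_definite_invertible)
  have DQ: "D ** Q = mat 1" "Q ** D = mat 1"
    using invertible_matrix_inv[OF invD] by (simp_all add: Q_def)
  have symQ: "transpose Q = Q"
    unfolding Q_def using invD symD by (rule transpose_matrix_inv)
  have pdQ: "positive_definite Q"
    unfolding Q_def using pdD symD by (rule positive_definite_matrix_inv)

  \<comment> \<open>\<open>E\<close> is the lower factor of \<open>M\<close>, and \<open>F\<close>
    will play the same role for \<open>M - G\<close>. The minus sign of \<open>F\<close> sits in the
    coefficient so that both fit the shape \<open>a *\<^sub>R D + b *\<^sub>R X\<close> of the
    expansion lemma.\<close>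
  define E where "E = D + \<omega> *\<^sub>R L"
  define F where "F = (1 - \<omega>) *\<^sub>R D + (- \<omega>) *\<^sub>R L"
  have tE: "transpose E = D + \<omega> *\<^sub>R transpose L"
    by (simp add: E_def transpose_add transpose_scalar symD)
  have tF: "transpose F = (1 - \<omega>) *\<^sub>R D + (- \<omega>) *\<^sub>R transpose L"
    unfolding F_def by (simp only: transpose_add transpose_scalar symD)
  have M: "M = c *\<^sub>R (E ** Q ** transpose E)"
    unfolding tE unfolding E_def
    by (simp add: M_def nr_ssor_M_def ssor_splitting_matrix_def Let_def c_def
        flip: G_def D_def L_def Q_def)
  have symM: "transpose M = M"
    by (simp add: M transpose_scalar matrix_transpose_mul symQ matrix_mul_assoc)
  have pdM: "positive_definite M"
    unfolding M
  \<comment> \<open>\<open>M\<close> is a positive multiple of a congruence of \<open>Q\<close>;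
    what remains is that the upper triangular \<open>transpose E\<close> has trivial kernel.\<close>
  proof (intro positive_definite_scaleR positive_definite_congruence pdQ c(1))
    show "y = 0" if "transpose E *v y = 0" for y
      using that diag unfolding tE D_def L_def
      by (intro upper_triangular_mult_vec_eq_0[of G \<omega> y]) (auto simp: less_imp_neq[symmetric])
  qed
  have invM: "invertible M"
    using pdM by (rule positive_definite_invertible)
  have symP: "transpose P = P"
    unfolding P_def using invM symM by (rule transpose_matrix_inv)
  have pdP: "positive_definite P"
    unfolding P_def using pdM symM by (rule positive_definite_matrix_inv)

  have "E ** Q ** transpose E
      = D + \<omega> *\<^sub>R (L + transpose L) + \<omega>\<^sup>2 *\<^sub>R (L ** Q ** transpose L)"
    using triangular_product_expansion[OF DQ, of 1 \<omega> L "transpose L"]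
    unfolding tE unfolding E_def by simp
  moreover have "F ** Q ** transpose F
      = (1 - \<omega>)\<^sup>2 *\<^sub>R D + ((1 - \<omega>) * (- \<omega>)) *\<^sub>R (L + transpose L)
        + (- \<omega>)\<^sup>2 *\<^sub>R (L ** Q ** transpose L)"
    unfolding tF unfolding F_def by (rule triangular_product_expansion[OF DQ])
  \<comment> \<open>The \<open>L ** Q ** transpose L\<close> terms cancel, while
    \<open>1 - (1 - \<omega>)\<^sup>2\<close> and
    \<open>\<omega> + (1 - \<omega>) * \<omega>\<close> both equal
    \<open>\<omega> * (2 - \<omega>)\<close>. So \<open>D\<close> and \<open>L + transpose L\<close>
    get the same coefficient and add up to a multiple of \<open>G\<close>, which \<open>c\<close>
    normalizes to 1.\<close>
  ultimately have "E ** Q ** transpose E - F ** Q ** transpose F = (\<omega> * (2 - \<omega>)) *\<^sub>R G"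
    by (subst G) (simp add: vec_eq_iff algebra_simps power2_eq_square)
  then have "c *\<^sub>R (E ** Q ** transpose E) - c *\<^sub>R (F ** Q ** transpose F) = G"
    using c(2) by (simp flip: scaleR_diff_right)
  then have "M - G = c *\<^sub>R (F ** Q ** transpose F)"
    by (simp add: M algebra_simps)
  then have psdN: "positive_semidefinite (M - G)"
    using pdQ c(1)
    by (simp add: positive_semidefinite_scaleR positive_semidefinite_congruence
        positive_definite_imp_positive_semidefinite)
  have symN: "transpose (M - G) = M - G"
    by (simp add: transpose_diff symM symG)
  \<comment> \<open>\<open>P ** M = mat 1\<close> turns \<open>mat 1 - P ** G\<close> into this
    product.\<close>
  have "nr_ssor_H \<omega> A = P ** (M - G)"
    using invertible_matrix_inv(2)[OF invM]
    by (simp add: nr_ssor_H_def matrix_diff_ldistrib P_def flip: G_def M_def)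
  then have "nr_ssor_C \<omega> A l = (\<Sum>i<l. matrix_pow (P ** (M - G)) i ** P)"
    by (simp add: nr_ssor_C_def P_def M_def)
  then show ?thesis
    using positive_definite_neumann_sum[OF symP symN pdP psdN] assms(4) by simp
qed

end
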